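(* Let $\Gamma$ be a finite semigroup and let $V$ be a proper prime subset of $\Gamma$ of smallest cardinality among all proper prime subsets of $\Gamma$. Then $r_5(\Gamma) = |\Gamma \setminus V| + 1$.
   Context: A nonempty subset $U$ of a (multiplicatively written) semigroup $\Gamma$ is called prime if, for all $a, b \in \Gamma$, $ab \in U$ implies $a \in U$ or $b \in U$. A prime subset $U$ is proper if $U \neq \Gamma$. For a finite semigroup $\Gamma$, the large rank of $\Gamma$ is $$r_5(\Gamma) = \min\{k : \text{every subset } U \text{ of cardinality } k \text{ in } \Gamma \text{ generates } \Gamma\},$$ where a subset $U$ generates $\Gamma$ if the subsemigroup $\langle U \rangle$ generated by $U$ equals $\Gamma$. *)

theory Defs
  imports Main
begin

definition prime_subset :: "'a::semigroup_mult set \<Rightarrow> bool" where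
  "prime_subset U \<longleftrightarrow> U \<noteq> {} \<and> (\<forall>a b. a * b \<in> U \<longrightarrow> a \<in> U \<or> b \<in> U)"

definition proper_prime_subset :: "'a::semigroup_mult set \<Rightarrow> bool" where
  "proper_prime_subset U \<longleftrightarrow> prime_subset U \<and> U \<noteq> UNIV"

inductive_set generated_subsemigroup :: "'a::semigroup_mult set \<Rightarrow> 'a set"
  for U :: "'a set" where
  incl: "a \<in> U \<Longrightarrow> a \<in> generated_subsemigroup U"
| mult: "a \<in> generated_subsemigroup U \<Longrightarrow> b \<in> generated_subsemigroup U
    \<Longrightarrow> a * b \<in> generated_subsemigroup U"

definition generates :: "'a::semigroup_mult set \<Rightarrow> bool" where
  "generates U \<longleftrightarrow> generated_subsemigroup U = UNIV"

text \<open>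
  The large rank depends only on the semigroup, hence on the type. The least element exists,
  and is at most the order of the semigroup, because the whole semigroup generates itself; the
  values of \<open>k\<close> beyond that order, for which the condition is vacuous, are therefore harmless.
\<close>

definition large_rank :: "'a::{semigroup_mult, finite} itself \<Rightarrow> nat" where
  "large_rank _ = (LEAST k. \<forall>U :: 'a set. card U = k \<longrightarrow> generates U)"

end

theory Submission
  imports Defs
begin

text \<open>
  Proper prime subsets are exactly the complements of the nonempty proper subsemigroups, so
  \<open>- V\<close> is a proper subsemigroup of largest cardinality. A set with more elements than that
  cannot lie in a proper subsemigroup, hence generates, while every subset of \<open>- V\<close> fails to.
\<close>

text \<open>Read contrapositively, primality of \<open>V\<close> says that \<open>- V\<close> is
  closed under multiplication.\<close>

lemma generated_subsemigroup_subset_Compl: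
  fixes V :: "'a::semigroup_mult set"
  assumes "prime_subset V" "U \<subseteq> - V"
  shows "generated_subsemigroup U \<subseteq> - V"
proof
  fix x assume "x \<in> generated_subsemigroup U"
  then show "x \<in> - V"
    by induction (use assms in \<open>auto simp: prime_subset_def\<close>)
qed

lemma not_generates_subset_Compl:
  fixes V :: "'a::semigroup_mult set"
  assumes "prime_subset V" "U \<subseteq> - V"
  shows "\<not> generates U"
  using generated_subsemigroup_subset_Compl[OF assms] assms(1)
  by (auto simp: generates_def prime_subset_def)

text \<open>Closure of the subsemigroup under products is primality of its complement;
  \<open>U \<noteq> {}\<close> makes that complement proper, and failure to generate makes it
  nonempty.\<close>

lemma proper_prime_subset_Compl_generated:
  fixes U :: "'a::semigroup_mult set"
  assumes "U \<noteq> {}" "\<not> generates U"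
  shows "proper_prime_subset (- generated_subsemigroup U)"
  using assms
  by (auto simp: proper_prime_subset_def prime_subset_def generates_def
      intro: generated_subsemigroup.intros)

theorem corollary2p3:
  fixes V :: "'a::{semigroup_mult, finite} set"
  assumes "proper_prime_subset V"
    and "\<And>W :: 'a set. proper_prime_subset W \<Longrightarrow> card V \<le> card W"
  shows "large_rank TYPE('a) = card (UNIV - V) + 1"
  unfolding large_rank_def
proof (rule Least_equality)
  show "\<forall>U :: 'a set. card U = card (UNIV - V) + 1 \<longrightarrow> generates U"
  proof (intro allI impI, rule ccontr)
    fix U :: "'a set"
    assume U: "card U = card (UNIV - V) + 1" and "\<not> generates U"
    moreover from U have "U \<noteq> {}" by auto
    ultimately have "card V \<le> card (- generated_subsemigroup U)"
      by (intro assms(2) proper_prime_subset_Compl_generated)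
    moreover have "- generated_subsemigroup U \<subseteq> - U"
      by (auto intro: generated_subsemigroup.incl)
    then have "card (- generated_subsemigroup U) \<le> card (- U)"
      by (intro card_mono) auto
    \<comment> \<open>Both sides are the order of the semigroup, so \<open>card (- U)\<close> is
      \<open>card V - 1\<close>, one below the minimum.\<close>
    moreover have "card (- U) + card U = card (UNIV - V) + card V"
      by (simp add: Compl_eq_Diff_UNIV card_Diff_subset card_mono)
    ultimately show False using U by linarith
  qed
next
  fix k assume k: "\<forall>U :: 'a set. card U = k \<longrightarrow> generates U"
  have V: "prime_subset V" using assms(1) by (simp add: proper_prime_subset_def)
  show "card (UNIV - V) + 1 \<le> k"
  proof (rule ccontr)
    assume "\<not> card (UNIV - V) + 1 \<le> k"
    then have "k \<le> card (- V)" by (simp add: Compl_eq_Diff_UNIV)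
    \<comment> \<open>The case \<open>k = 0\<close> is included: \<open>U\<close> is then empty, and
      the empty set generates only itself.\<close>
    then obtain U where "U \<subseteq> - V" "card U = k"
      by (meson obtain_subset_with_card_n)
    then show False using k not_generates_subset_Compl[OF V] by blast
  qed
qed

end
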